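(* Let $\lambda\in\mathbb{R}\setminus\{0\}$ be such that $e_0(\lambda)\neq 0$. Then the Jost solution $e(\lambda,x)$ of the equation $$-y''(x)+\int_{\mathbb{R}_+}\sum_{k=1}^n\alpha_k v_k(x)\overline{v_k(t)}\,y(t)\,dt=\lambda^2 y(x)\quad (x\in\mathbb{R}_+),$$ i.e. the solution satisfying the boundary condition $$\lim_{x\to\infty}e^{-i\lambda x}e(\lambda,x)=e_0(\lambda),$$ is $$e(\lambda,x)=e^{i\lambda x}e_0(\lambda)+\sum_{k=1}^n\alpha_k e_k(\lambda)\psi_k(\lambda,x),$$ where $$\psi_k(\lambda,x)=\int_x^\infty\frac{\sin\lambda(t-x)}{\lambda}v_k(t)\,dt\quad(1\le k\le n).$$
   Context: Let $n\in\mathbb{N}$, let $\alpha_1,\dots,\alpha_n$ be non-zero real numbers, and let $v_1,\dots,v_n$ be linearly independent complex-valued functions on $\mathbb{R}_+=(0,\infty)$ with $\int_{\mathbb{R}_+}(1+x^2)|v_k(x)|^2dx<\infty$ for all $k$. For real $\lambda$: $\widetilde v_k(\lambda)=\int_{\mathbb{R}_+}e^{-i\lambda x}v_k(x)\,dx$ and $\widetilde v_k^*(\lambda)=\overline{\widetilde v_k(\overline{\lambda})}$. For real $\lambda\ne0$: $$\varphi_{s,k}(\lambda)=\int_{\mathbb{R}_+}\left(\int_x^\infty\frac{\sin\lambda(t-x)}{\lambda}v_s(t)\,dt\right)\overline{v_k(x)}\,dx\quad(1\le s,k\le n).$$ Let $M(\lambda)$ be the $n\times n$ matrix whose entry in row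 $k$, column $s$ is $\alpha_s\varphi_{s,k}(\lambda)-\delta_{s,k}$. Then $e_0(\lambda)=\det M(\lambda)$, and for $1\le j\le n$, $e_j(\lambda)=-\det M_j(\lambda)$, where $M_j(\lambda)$ is obtained from $M(\lambda)$ by replacing its $j$-th column by the column $(\widetilde v_1^*(\lambda),\dots,\widetilde v_n^*(\lambda))^{T}$. *)

theory Defs
  imports "HOL-Analysis.Analysis"
begin

text \<open>
  The half-line is \<open>{0<..}\<close>; functions on it are total functions on the reals of which only the
  values at positive arguments are ever used. The index set \<open>{1..n}\<close> is a finite type
  \<open>'n\<close>, so that \<open>n = CARD('n)\<close>. All integrals are Lebesgue integrals.
\<close>

definition weighted_L2 :: "(real \<Rightarrow> complex) \<Rightarrow> bool" where
  "weighted_L2 f \<longleftrightarrow>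
     set_borel_measurable lebesgue {0<..} f \<and>
     set_integrable lebesgue {0<..} (\<lambda>x. (1 + x\<^sup>2) * (cmod (f x))\<^sup>2)"

text \<open>
  Linear independence over the complex numbers of the family of restrictions to the half-line, taken
  pointwise. Independence modulo null sets implies this condition.
\<close>

definition lin_indep_halfline :: "('n::finite \<Rightarrow> real \<Rightarrow> complex) \<Rightarrow> bool" where
  "lin_indep_halfline v \<longleftrightarrow>
     (\<forall>c :: 'n \<Rightarrow> complex. (\<forall>x>0. (\<Sum>k\<in>UNIV. c k * v k x) = 0) \<longrightarrow> (\<forall>k. c k = 0))"

definition vtilde :: "(real \<Rightarrow> complex) \<Rightarrow> real \<Rightarrow> complex" where
  "vtilde f lam = (LINT x:{0<..}|lebesgue. exp (- \<i> * complex_of_real lam * complex_of_real x) * f x)"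

text \<open>The argument is real, so conjugating it has no effect.\<close>

definition vtilde_star :: "(real \<Rightarrow> complex) \<Rightarrow> real \<Rightarrow> complex" where
  "vtilde_star f lam = cnj (vtilde f lam)"

definition psi :: "(real \<Rightarrow> complex) \<Rightarrow> real \<Rightarrow> real \<Rightarrow> complex" where
  "psi f lam x = (LINT t:{x<..}|lebesgue. complex_of_real (sin (lam * (t - x)) / lam) * f t)"

definition phi :: "('n \<Rightarrow> real \<Rightarrow> complex) \<Rightarrow> real \<Rightarrow> 'n \<Rightarrow> 'n \<Rightarrow> complex" where
  "phi v lam s k = (LINT x:{0<..}|lebesgue. psi (v s) lam x * cnj (v k x))"

text \<open>In \<open>\<chi> k s\<close> the first index is the row and the second the column.\<close>

definition M_mat ::
  "('n::finite \<Rightarrow> real) \<Rightarrow> ('n \<Rightarrow> real \<Rightarrow> complex) \<Rightarrow> real \<Rightarrow> complex^'n^'n" where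
  "M_mat \<alpha> v lam =
     (\<chi> k s. complex_of_real (\<alpha> s) * phi v lam s k - (if s = k then 1 else 0))"

definition M_mat_repl ::
  "('n::finite \<Rightarrow> real) \<Rightarrow> ('n \<Rightarrow> real \<Rightarrow> complex) \<Rightarrow> 'n \<Rightarrow> real \<Rightarrow> complex^'n^'n" where
  "M_mat_repl \<alpha> v j lam =
     (\<chi> k s. if s = j then vtilde_star (v k) lam else M_mat \<alpha> v lam $ k $ s)"

definition e0 :: "('n::finite \<Rightarrow> real) \<Rightarrow> ('n \<Rightarrow> real \<Rightarrow> complex) \<Rightarrow> real \<Rightarrow> complex" where
  "e0 \<alpha> v lam = det (M_mat \<alpha> v lam)"

definition e_coef ::
  "('n::finite \<Rightarrow> real) \<Rightarrow> ('n \<Rightarrow> real \<Rightarrow> complex) \<Rightarrow> 'n \<Rightarrow> real \<Rightarrow> complex" where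
  "e_coef \<alpha> v j lam = - det (M_mat_repl \<alpha> v j lam)"

text \<open>
  \<open>f\<close> is locally absolutely continuous on the half-line with derivative \<open>g\<close>: \<open>f\<close> is an indefinite
  integral of the locally integrable function \<open>g\<close> (which determines \<open>g\<close> almost everywhere).
\<close>

definition loc_ac_deriv :: "(real \<Rightarrow> complex) \<Rightarrow> (real \<Rightarrow> complex) \<Rightarrow> bool" where
  "loc_ac_deriv f g \<longleftrightarrow>
     (\<forall>a b. 0 < a \<and> a \<le> b \<longrightarrow>
        set_integrable lebesgue {a..b} g \<and> f b - f a = (LINT t:{a..b}|lebesgue. g t))"

text \<open>
  Solutions in the Caratheodory sense, as the \<open>v k\<close> are merely square integrable: \<open>y\<close> is
  differentiable, \<open>y'\<close> (called \<open>y1\<close>) is locally absolutely continuous with derivative \<open>y2\<close>, the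
  integrals of \<open>y\<close> against the conjugates of the \<open>v k\<close> converge absolutely, and the equation holds
  almost everywhere.
\<close>

definition is_solution ::
  "('n::finite \<Rightarrow> real) \<Rightarrow> ('n \<Rightarrow> real \<Rightarrow> complex) \<Rightarrow> real \<Rightarrow> (real \<Rightarrow> complex) \<Rightarrow> bool" where
  "is_solution \<alpha> v lam y \<longleftrightarrow>
     (\<forall>k. set_integrable lebesgue {0<..} (\<lambda>t. cnj (v k t) * y t)) \<and>
     (\<exists>y1 y2.
        (\<forall>x>0. (y has_vector_derivative y1 x) (at x)) \<and>
        loc_ac_deriv y1 y2 \<and>
        (AE x in lebesgue. 0 < x \<longrightarrow>
           - y2 x
           + (LINT t:{0<..}|lebesgue.
                (\<Sum>k\<in>UNIV. complex_of_real (\<alpha> k) * v k x * cnj (v k t)) * y t)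
           = complex_of_real (lam\<^sup>2) * y x))"

definition is_Jost_solution ::
  "('n::finite \<Rightarrow> real) \<Rightarrow> ('n \<Rightarrow> real \<Rightarrow> complex) \<Rightarrow> real \<Rightarrow> (real \<Rightarrow> complex) \<Rightarrow> bool" where
  "is_Jost_solution \<alpha> v lam y \<longleftrightarrow>
     is_solution \<alpha> v lam y \<and>
     ((\<lambda>x. exp (- \<i> * complex_of_real lam * complex_of_real x) * y x) \<longlongrightarrow> e0 \<alpha> v lam) at_top"

end

theory Submission
  imports Defs "HOL-Probability.Sinc_Integral"
begin

text \<open>
  Each \<open>psi (v k) lam\<close> solves \<open>u'' + lam\<^sup>2 * u = v k\<close> and vanishes at infinity. Given a solution \<open>y\<close>, put
  \<open>c k = \<integral> cnj (v k) * y\<close>. Then \<open>y\<close> minus \<open>\<Sum>k. \<alpha> k * c k * psi (v k) lam\<close> solves the free equation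
  \<open>u'' + lam\<^sup>2 * u = 0\<close>, and the boundary condition at infinity forces it to be
  \<open>exp (\<i> * lam * x) * e0\<close>. Integrating the resulting formula for \<open>y\<close> against \<open>cnj (v k)\<close> gives a linear
  system for \<open>c\<close> with matrix \<open>M_mat\<close> and right-hand side \<open>- e0\<close> times the column of the
  \<open>vtilde_star (v k) lam\<close>. As \<open>e0 = det M_mat\<close>, Cramer's rule turns this into \<open>c k = e_coef k\<close>. Conversely,
  with \<open>c k = e_coef k\<close> the same system says that the nonlocal term of the equation is the required one.
\<close>

section \<open>Lebesgue measure and integrability on the half-line\<close>

lemma lebesgue_measurable_borel:
  fixes f :: "'a::euclidean_space \<Rightarrow> 'b::topological_space"
  assumes "f \<in> borel_measurable borel"
  shows "f \<in> borel_measurable lebesgue"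
  using assms by (intro measurable_completion) simp

text \<open>Makes Fubini available for the product of \<open>lebesgue\<close> with itself.
  Completion keeps the measure of Borel sets, so a countable cover for \<open>lborel\<close> still
  serves.\<close>

lemma sigma_finite_lebesgue: "sigma_finite_measure (lebesgue :: 'a::euclidean_space measure)"
proof
  obtain A :: "'a set set" where A: "countable A" "A \<subseteq> sets lborel" "\<Union>A = space lborel"
      "\<forall>a\<in>A. emeasure lborel a \<noteq> \<infinity>"
    using lborel.sigma_finite_countable by blast
  then show "\<exists>A::'a set set. countable A \<and> A \<subseteq> sets lebesgue \<and> \<Union>A = space lebesgue \<and>
      (\<forall>a\<in>A. emeasure lebesgue a \<noteq> \<infinity>)"
    by (intro exI[of _ A]) (auto simp: emeasure_completion subset_iff)
qed

lemma AE_lebesgue_neq: "AE x in lebesgue. x \<noteq> (c::'a::euclidean_space)"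
  by (rule AE_I'[of "{c}"]) auto

lemma set_integrable_bounded_mult:
  fixes f g :: "real \<Rightarrow> complex"
  assumes f: "set_integrable lebesgue A f" and A: "A \<in> sets borel"
    and g: "continuous_on A g" and B: "\<And>x. x \<in> A \<Longrightarrow> norm (g x) \<le> B"
  shows "set_integrable lebesgue A (\<lambda>x. g x * f x)"
proof -
  have "(\<lambda>x. indicator A x *\<^sub>R g x) \<in> borel_measurable lebesgue"
    by (intro lebesgue_measurable_borel borel_measurable_continuous_on_indicator A g)
  moreover have "(\<lambda>x. indicator A x *\<^sub>R f x) \<in> borel_measurable lebesgue"
    using f by (auto simp: set_integrable_def)
  ultimately have "(\<lambda>x. (indicator A x *\<^sub>R g x) * (indicator A x *\<^sub>R f x)) \<in> borel_measurable lebesgue"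
    by (rule borel_measurable_times)
  \<comment> \<open>The indicator is idempotent, so the product of the two truncated factors is the
    truncated product.\<close>
  also have "(\<lambda>x. (indicator A x *\<^sub>R g x) * (indicator A x *\<^sub>R f x)) = (\<lambda>x. indicator A x *\<^sub>R (g x * f x))"
    by (auto split: split_indicator)
  finally have m: "set_borel_measurable lebesgue A (\<lambda>x. g x * f x)"
    by (simp add: set_borel_measurable_def)
  have "set_integrable lebesgue A (\<lambda>x. of_real B * f x)"
    using f by auto
  then show ?thesis
    using m by (rule set_integrable_bound)
      (auto simp: norm_mult intro!: mult_right_mono order_trans[OF B])
qed

text \<open>In place of Cauchy-Schwarz, the pointwise bound |f| \<le> 1/p + p |f|^2 with p = 1 + x^2
  dominates f by two integrable functions.\<close>

lemma weighted_L2_imp_set_integrable: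
  assumes "weighted_L2 f"
  shows "set_integrable lebesgue {0<..} f"
proof -
  have m: "set_borel_measurable lebesgue {0<..} f"
    and w: "set_integrable lebesgue {0<..} (\<lambda>x. (1 + x\<^sup>2) * (cmod (f x))\<^sup>2)"
    using assms by (auto simp: weighted_L2_def)
  have "set_integrable lborel (einterval (-\<infinity>) \<infinity>) (\<lambda>x::real. inverse (1 + x\<^sup>2))"
    using integrable_inverse_1_plus_square .
  then have "set_integrable lebesgue UNIV (\<lambda>x::real. inverse (1 + x\<^sup>2))"
    by (simp add: einterval_eq_UNIV set_integrable_def integrable_completion)
  then have i: "set_integrable lebesgue {0<..} (\<lambda>x::real. inverse (1 + x\<^sup>2))"
    by (rule set_integrable_subset) auto
  have le: "cmod (f x) \<le> inverse (1 + x\<^sup>2) + (1 + x\<^sup>2) * (cmod (f x))\<^sup>2" for x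
  proof -
    define p where "p = 1 + x\<^sup>2"
    have p: "p > 0"
      by (auto simp: p_def add_pos_nonneg)
    \<comment> \<open>With a = \<open>p * cmod (f x)\<close>, expanding the square yields a \<le> 1
      + a^2.\<close>
    have "0 \<le> (p * cmod (f x) - 1)\<^sup>2 + p * cmod (f x)"
      using p by simp
    then have "p * cmod (f x) \<le> 1 + (p * cmod (f x))\<^sup>2"
      by (simp add: power2_eq_square algebra_simps)
    then have "cmod (f x) \<le> (1 + (p * cmod (f x))\<^sup>2) / p"
      using p by (simp add: field_simps)
    also have "\<dots> = inverse p + p * (cmod (f x))\<^sup>2"
      using p by (simp add: field_simps power2_eq_square)
    finally show ?thesis
      by (simp add: p_def)
  qed
  show ?thesis
    by (rule set_integrable_bound[OF set_integral_add(1)[OF i w] m])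
      (auto intro!: AE_I2 order_trans[OF le])
qed

section \<open>Locally absolutely continuous functions\<close>

lemma loc_ac_deriv_continuous_on:
  assumes "loc_ac_deriv F g"
  shows "continuous_on {0<..} F"
proof -
  have "isCont F x" if "x > 0" for x
  proof -
    \<comment> \<open>Any compact interval inside the open half-line with x in its interior would
      do; \<open>loc_ac_deriv\<close> gives no information at 0.\<close>
    define a b where "a = x / 2" and "b = x + 1"
    have ab: "0 < a" "a < x" "x < b"
      using that by (auto simp: a_def b_def)
    have eq: "F u = F a + integral {a..u} g" if "u \<in> {a..b}" for u
    proof -
      have "set_integrable lebesgue {a..u} g" "F u - F a = (LINT t:{a..u}|lebesgue. g t)"
        using assms ab that by (auto simp: loc_ac_deriv_def)
      then show ?thesis
        by (simp add: set_lebesgue_integral_eq_integral algebra_simps)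
    qed
    have "set_integrable lebesgue {a..b} g"
      using assms ab by (auto simp: loc_ac_deriv_def)
    then have "continuous_on {a..b} (\<lambda>u. F a + integral {a..u} g)"
      by (intro continuous_intros indefinite_integral_continuous_1 set_lebesgue_integral_eq_integral(1))
    then have "continuous_on {a..b} F"
      by (rule continuous_on_eq) (rule eq[symmetric])
    then show ?thesis
      using ab by (intro continuous_on_interior) auto
  qed
  then show ?thesis
    by (simp add: continuous_on_eq_continuous_at)
qed

text \<open>Regularity bootstrap by the fundamental theorem of calculus: a continuous density is a
  derivative at every point, not merely almost everywhere. It is applied to \<open>psi\<close> and
  to the derivative of a free solution.\<close>

lemma loc_ac_deriv_has_vector_derivative:
  assumes F: "loc_ac_deriv F g" and g: "continuous_on {0<..} g" and x: "x > 0"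
  shows "(F has_vector_derivative g x) (at x)"
proof -
  define a b where "a = x / 2" and "b = x + 1"
  have ab: "0 < a" "a < x" "x < b"
    using x by (auto simp: a_def b_def)
  have "continuous_on {a..b} g"
    using g by (rule continuous_on_subset) (use ab in auto)
  then have "((\<lambda>u. F a + integral {a..u} g) has_vector_derivative 0 + g x) (at x within {a..b})"
    using ab by (intro has_vector_derivative_add has_vector_derivative_const
        integral_has_vector_derivative) auto
  then have "((\<lambda>u. F a + integral {a..u} g) has_vector_derivative g x) (at x within {a..b})"
    by simp
  moreover have "F a + integral {a..u} g = F u" if "u \<in> {a..b}" for u
  proof -
    have "set_integrable lebesgue {a..u} g" "F u - F a = (LINT t:{a..u}|lebesgue. g t)"
      using F ab that by (auto simp: loc_ac_deriv_def)
    then show ?thesis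
      by (simp add: set_lebesgue_integral_eq_integral algebra_simps)
  qed
  ultimately have "(F has_vector_derivative g x) (at x within {a..b})"
    using ab by (intro has_vector_derivative_transform[of x "{a..b}" F]) auto
  then show ?thesis
    using ab at_within_interior[of x "{a..b}"] by simp
qed

lemma loc_ac_deriv_C1:
  assumes "\<And>x. x > 0 \<Longrightarrow> (F has_vector_derivative g x) (at x)" "continuous_on {0<..} g"
  shows "loc_ac_deriv F g"
  unfolding loc_ac_deriv_def
proof (intro allI impI)
  fix a b :: real
  assume ab: "0 < a \<and> a \<le> b"
  have "continuous_on {a..b} g"
    using assms(2) by (rule continuous_on_subset) (use ab in auto)
  then have int: "set_integrable lebesgue {a..b} g"
    using borel_integrable_compact[of "{a..b}" g]
    by (auto simp: set_integrable_def integrable_completion borel_measurable_integrable)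
  have "(g has_integral (F b - F a)) {a..b}"
    using ab by (intro fundamental_theorem_of_calculus)
      (auto intro!: has_vector_derivative_at_within assms(1))
  then show "set_integrable lebesgue {a..b} g \<and> F b - F a = (LINT t:{a..b}|lebesgue. g t)"
    using int by (simp add: set_lebesgue_integral_eq_integral integral_unique)
qed

lemma loc_ac_deriv_add:
  assumes "loc_ac_deriv F f" "loc_ac_deriv G g"
  shows "loc_ac_deriv (\<lambda>x. F x + G x) (\<lambda>x. f x + g x)"
  using assms by (fastforce simp: loc_ac_deriv_def algebra_simps)

lemma loc_ac_deriv_cmult:
  assumes "loc_ac_deriv F f"
  shows "loc_ac_deriv (\<lambda>x. c * F x) (\<lambda>x. c * f x)"
  using assms by (auto simp: loc_ac_deriv_def right_diff_distrib[symmetric])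

lemma loc_ac_deriv_sum:
  assumes "\<And>k. k \<in> K \<Longrightarrow> loc_ac_deriv (F k) (f k)"
  shows "loc_ac_deriv (\<lambda>x. \<Sum>k\<in>K. F k x) (\<lambda>x. \<Sum>k\<in>K. f k x)"
  using assms
proof (induction K rule: infinite_finite_induct)
  case (insert k K)
  then show ?case by (auto intro!: loc_ac_deriv_add)
qed (simp_all add: loc_ac_deriv_def set_integrable_def)

section \<open>Integrals over the tail (x, infinity) with a kernel in t - x\<close>

text \<open>A general kernel treats \<open>psi\<close> (kernel sin(lam s)/lam) and its derivative
  (kernel -cos(lam s)) together.\<close>

definition tail_conv :: "(real \<Rightarrow> complex) \<Rightarrow> (real \<Rightarrow> complex) \<Rightarrow> real \<Rightarrow> complex" where
  "tail_conv k f x = (LINT t:{x<..}|lebesgue. k (t - x) * f t)"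

lemma set_integrable_tail_conv:
  fixes f k :: "real \<Rightarrow> complex"
  assumes f: "set_integrable lebesgue {0<..} f" and k: "continuous_on UNIV k"
    and B: "\<And>s. norm (k s) \<le> B" and x: "0 \<le> x"
  shows "set_integrable lebesgue {x<..} (\<lambda>t. k (t - x) * f t)"
proof (rule set_integrable_bounded_mult)
  show "set_integrable lebesgue {x<..} f"
    using f by (rule set_integrable_subset) (use x in auto)
  show "continuous_on {x<..} (\<lambda>t. k (t - x))"
    by (intro continuous_on_compose2[OF k] continuous_intros) auto
qed (auto intro: B)

lemma norm_tail_conv_le:
  fixes f k :: "real \<Rightarrow> complex"
  assumes f: "set_integrable lebesgue {0<..} f" and k: "continuous_on UNIV k"
    and B: "\<And>s. norm (k s) \<le> B" and x: "0 \<le> x"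
  shows "norm (tail_conv k f x) \<le> B * (LINT t:{0<..}|lebesgue. norm (f t))"
proof -
  have B0: "0 \<le> B"
    using B[of 0] norm_ge_zero order_trans by blast
  have nf: "set_integrable lebesgue {0<..} (\<lambda>t. norm (f t))"
    using f by (rule set_integrable_norm)
  have "norm (tail_conv k f x) \<le> (LINT t:{x<..}|lebesgue. norm (k (t - x) * f t))"
    unfolding tail_conv_def
    by (intro set_integral_norm_bound set_integrable_tail_conv[OF assms])
  also have "\<dots> \<le> (LINT t|lebesgue. B * (indicator {0<..} t *\<^sub>R norm (f t)))"
    unfolding set_lebesgue_integral_def
  proof (rule integral_mono)
    show "integrable lebesgue (\<lambda>t. indicator {x<..} t *\<^sub>R norm (k (t - x) * f t))"
      using set_integrable_norm[OF set_integrable_tail_conv[OF assms]] by (simp add: set_integrable_def)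
    show "integrable lebesgue (\<lambda>t. B * (indicator {0<..} t *\<^sub>R norm (f t)))"
      using nf by (intro integrable_mult_right) (simp add: set_integrable_def)
  qed (use x B0 in \<open>auto split: split_indicator simp: norm_mult intro!: mult_right_mono B\<close>)
  also have "\<dots> = B * (LINT t:{0<..}|lebesgue. norm (f t))"
    by (simp add: set_lebesgue_integral_def)
  finally show ?thesis .
qed

text \<open>Dominated convergence with majorant B |f|: for fixed t the integrand vanishes as soon as
  x \<ge> t.\<close>

lemma tail_conv_tendsto_0:
  fixes f k :: "real \<Rightarrow> complex"
  assumes f: "set_integrable lebesgue {0<..} f" and k: "continuous_on UNIV k"
    and B: "\<And>s. norm (k s) \<le> B"
  shows "(tail_conv k f \<longlongrightarrow> 0) at_top"
proof -
  have B0: "0 \<le> B"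
    using B[of 0] norm_ge_zero order_trans by blast
  have nf: "set_integrable lebesgue {0<..} (\<lambda>t. norm (f t))"
    using f by (rule set_integrable_norm)
  \<comment> \<open>Since \<open>f\<close> is controlled only on the half-line,
    \<open>max 0 x\<close> keeps measurability and the majorant valid for every real x. For x \<ge>
    0 nothing changes.\<close>
  have "((\<lambda>x. integral\<^sup>L lebesgue (\<lambda>t. indicator {max 0 x<..} t *\<^sub>R (k (t - max 0 x) * f t)))
      \<longlongrightarrow> integral\<^sup>L lebesgue (\<lambda>t::real. 0)) at_top"
  proof (rule integral_dominated_convergence_at_top)
    show "integrable lebesgue (\<lambda>t. B * (indicator {0<..} t *\<^sub>R norm (f t)))"
      using nf by (intro integrable_mult_right) (simp add: set_integrable_def)
    show "(\<lambda>t. indicator {max 0 x<..} t *\<^sub>R (k (t - max 0 x) * f t)) \<in> borel_measurable lebesgue" for x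
      using set_integrable_tail_conv[OF assms, of "max 0 x"] by (auto simp: set_integrable_def)
    show "\<forall>\<^sub>F x in at_top. AE t in lebesgue.
        norm (indicator {max 0 x<..} t *\<^sub>R (k (t - max 0 x) * f t)) \<le> B * (indicator {0<..} t *\<^sub>R norm (f t))"
      using B0 by (intro always_eventually allI AE_I2)
        (auto split: split_indicator simp: norm_mult intro!: mult_right_mono B)
    show "AE t in lebesgue. ((\<lambda>x. indicator {max 0 x<..} t *\<^sub>R (k (t - max 0 x) * f t)) \<longlongrightarrow> 0) at_top"
    proof (intro AE_I2 tendsto_eventually)
      fix t :: real
      show "\<forall>\<^sub>F x in at_top. indicator {max 0 x<..} t *\<^sub>R (k (t - max 0 x) * f t) = 0"
        using eventually_ge_at_top[of t] by eventually_elim (auto split: split_indicator)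
    qed
  qed auto
  moreover have "\<forall>\<^sub>F x in at_top. integral\<^sup>L lebesgue (\<lambda>t. indicator {max 0 x<..} t *\<^sub>R (k (t - max 0 x) * f t))
      = tail_conv k f x"
    using eventually_ge_at_top[of 0]
    by eventually_elim (auto simp: tail_conv_def set_lebesgue_integral_def max_def)
  ultimately show ?thesis
    unfolding integral_zero by (rule Lim_transform_eventually)
qed

text \<open>
  The function \<open>f\<close> is only integrable, so one cannot differentiate under the integral sign. Instead,
  \<open>tail_conv k' f\<close> is integrated over \<open>{a..b}\<close> and the order of integration is exchanged.
\<close>

lemma loc_ac_deriv_tail_conv:
  fixes f k k' :: "real \<Rightarrow> complex"
  assumes f: "set_integrable lebesgue {0<..} f"
    and deriv: "\<And>s. (k has_vector_derivative k' s) (at s)" and k': "continuous_on UNIV k'"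
    and B: "\<And>s. norm (k s) \<le> B" and B': "\<And>s. norm (k' s) \<le> B'"
  shows "loc_ac_deriv (tail_conv k f) (\<lambda>x. - k 0 * f x - tail_conv k' f x)"
  unfolding loc_ac_deriv_def
proof (intro allI impI)
  fix a b :: real
  assume "0 < a \<and> a \<le> b"
  then have a: "0 < a" and ab: "a \<le> b"
    by auto
  interpret lebesgue: sigma_finite_measure "lebesgue :: real measure"
    by (rule sigma_finite_lebesgue)
  interpret P: pair_sigma_finite "lebesgue :: real measure" "lebesgue :: real measure" ..
  have k: "continuous_on UNIV k"
    using deriv by (meson continuous_at_imp_continuous_on has_vector_derivative_continuous)
  have B'0: "0 \<le> B'"
    using B'[of 0] norm_ge_zero order_trans by blast
  \<comment> \<open>Extension of \<open>f\<close> by zero, integrable on the whole line as the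
    product measure requires.\<close>
  define F where "F t = indicator {0<..} t *\<^sub>R f t" for t
  have F: "integrable lebesgue F"
    using f by (simp add: F_def[abs_def] set_integrable_def)
  then have [measurable]: "F \<in> borel_measurable lebesgue"
    by auto
  have [measurable]: "k' \<in> borel_measurable borel"
    using k' by (rule borel_measurable_continuous_onI)
  have [measurable]: "(\<lambda>x. x) \<in> borel_measurable (lebesgue :: real measure)"
    by (rule lebesgue_measurable_borel) simp
  \<comment> \<open>The joint integrand. Integrating over t first gives
    \<open>tail_conv k' f\<close> on \<open>{a..b}\<close>; integrating over x first gives
    differences of \<open>k\<close>.\<close>
  define G where "G x t = (if a \<le> x \<and> x \<le> b \<and> x < t then k' (t - x) * F t else 0)" for x t
  have "(\<lambda>p. G (fst p) (snd p)) \<in> borel_measurable (lebesgue \<Otimes>\<^sub>M lebesgue)"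
    unfolding G_def by measurable
  then have Gm: "case_prod G \<in> borel_measurable (lebesgue \<Otimes>\<^sub>M lebesgue)"
    by (simp add: case_prod_beta')
  \<comment> \<open>The majorant is a product of an indicator of a bounded interval and an
    integrable function, hence integrable on the plane.\<close>
  have int_bound: "integrable (lebesgue \<Otimes>\<^sub>M lebesgue) (\<lambda>(x, t). indicator {a..b} x * (B' * norm (F t)))"
  proof (rule P.Fubini_integrable)
    show "(\<lambda>(x, t). indicator {a..b} x * (B' * norm (F t))) \<in> borel_measurable (lebesgue \<Otimes>\<^sub>M lebesgue)"
      by measurable
    have "integrable lebesgue (indicator {a..b} :: real \<Rightarrow> real)"
      using lmeasurable_iff_integrable[of "{a..b}"] by simp
    then show "integrable lebesgue
        (\<lambda>x. LINT t|lebesgue. norm (case (x, t) of (x, t) \<Rightarrow> indicator {a..b} x * (B' * norm (F t))))"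
      using B'0 by (simp add: abs_mult)
    show "AE x in lebesgue. integrable lebesgue
        (\<lambda>t. case (x, t) of (x, t) \<Rightarrow> indicator {a..b} x * (B' * norm (F t)))"
      using F by auto
  qed
  have G_int: "integrable (lebesgue \<Otimes>\<^sub>M lebesgue) (case_prod G)"
    using int_bound Gm
  proof (rule Bochner_Integration.integrable_bound)
    show "AE p in lebesgue \<Otimes>\<^sub>M lebesgue.
        norm (case_prod G p) \<le> norm (case p of (x, t) \<Rightarrow> indicator {a..b} x * (B' * norm (F t)))"
      using B'0 by (intro AE_I2) (auto simp: G_def norm_mult abs_mult intro!: mult_right_mono B' split: split_indicator)
  qed
  have inner_t: "(LINT t|lebesgue. G x t) = indicator {a..b} x *\<^sub>R tail_conv k' f x" for x
    using a by (auto simp: G_def F_def tail_conv_def set_lebesgue_integral_def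
        intro!: Bochner_Integration.integral_cong split: split_indicator)
  have k'_int: "(LINT x:{a..c}|lebesgue. k' (t - x)) = k (t - a) - k (t - c)"
    "set_integrable lebesgue {a..c} (\<lambda>x. k' (t - x))" if "a \<le> c" for t c
  proof -
    have cont: "continuous_on {a..c} (\<lambda>x. k' (t - x))"
      by (intro continuous_on_compose2[OF k'] continuous_intros) auto
    then show int: "set_integrable lebesgue {a..c} (\<lambda>x. k' (t - x))"
      using borel_integrable_compact[of "{a..c}" "\<lambda>x. k' (t - x)"]
      by (auto simp: set_integrable_def integrable_completion borel_measurable_integrable)
    \<comment> \<open>As a function of x, the antiderivative of k'(t - x) is -k(t - x).\<close>
    have "((\<lambda>x. k' (t - x)) has_integral (- k (t - c) - - k (t - a))) {a..c}"
    proof (rule fundamental_theorem_of_calculus[OF that])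
      fix x
      have "((\<lambda>x. t - x) has_vector_derivative 0 - 1) (at x within {a..c})"
        by (intro has_vector_derivative_diff has_vector_derivative_const has_vector_derivative_id)
      from vector_diff_chain_within[OF this has_vector_derivative_at_within[OF deriv]]
      have "((\<lambda>x. k (t - x)) has_vector_derivative (0 - 1) *\<^sub>R k' (t - x)) (at x within {a..c})"
        by (simp only: o_def)
      from has_vector_derivative_minus[OF this]
      show "((\<lambda>x. - k (t - x)) has_vector_derivative k' (t - x)) (at x within {a..c})"
        by simp
    qed
    then show "(LINT x:{a..c}|lebesgue. k' (t - x)) = k (t - a) - k (t - c)"
      using int by (simp add: set_lebesgue_integral_eq_integral integral_unique)
  qed
  have inner_x: "(LINT x|lebesgue. G x t) = (if a < t then (k (t - a) - k (t - min b t)) * F t else 0)" for t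
  proof (cases "a < t")
    case True
    have "(LINT x|lebesgue. G x t) = (LINT x|lebesgue. (indicator {a..min b t} x *\<^sub>R k' (t - x)) * F t)"
    proof (rule integral_cong_AE)
      show "(\<lambda>x. G x t) \<in> borel_measurable lebesgue"
        unfolding G_def by measurable
      show "(\<lambda>x. (indicator {a..min b t} x *\<^sub>R k' (t - x)) * F t) \<in> borel_measurable lebesgue"
        by measurable
      \<comment> \<open>The two sides can differ only at x = t, which \<open>G\<close> excludes and
        the closed interval may contain.\<close>
      show "AE x in lebesgue. G x t = (indicator {a..min b t} x *\<^sub>R k' (t - x)) * F t"
        using AE_lebesgue_neq[of t] by eventually_elim (auto simp: G_def split: split_indicator)
    qed
    also have "\<dots> = (LINT x:{a..min b t}|lebesgue. k' (t - x)) * F t"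
      by (simp only: set_lebesgue_integral_def integral_mult_left_zero)
    also have "\<dots> = (k (t - a) - k (t - min b t)) * F t"
      using True ab by (subst k'_int) auto
    finally show ?thesis
      using True by simp
  next
    case False
    then have "(\<lambda>x. G x t) = (\<lambda>x. 0)"
      by (intro ext) (auto simp: G_def)
    then show ?thesis
      using False by simp
  qed
  have k_int: "set_integrable lebesgue {x<..} (\<lambda>t. k (t - x) * f t)" if "0 < x" for x
    using that by (intro set_integrable_tail_conv[OF f k B]) auto
  have f_int: "set_integrable lebesgue {a..b} f"
    using f by (rule set_integrable_subset) (use a in auto)
  have "integrable lebesgue (\<lambda>x. LINT t|lebesgue. G x t)"
    using P.integrable_fst'[OF G_int] by simp
  then have tail_int: "set_integrable lebesgue {a..b} (tail_conv k' f)"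
    by (simp add: inner_t set_integrable_def)
  have "(LINT x:{a..b}|lebesgue. tail_conv k' f x) = (LINT x|lebesgue. LINT t|lebesgue. G x t)"
    by (simp add: inner_t set_lebesgue_integral_def)
  also have "\<dots> = (LINT t|lebesgue. LINT x|lebesgue. G x t)"
    by (rule P.Fubini_integral[OF G_int, symmetric])
  \<comment> \<open>For t \<le> b the term \<open>k (t - min b t)\<close> is \<open>k 0\<close>,
    which produces the boundary term; for t > b it is \<open>k (t - b)\<close>. The point t = a is
    discarded as a null set.\<close>
  also have "\<dots> = (LINT t|lebesgue. indicator {a<..} t *\<^sub>R (k (t - a) * f t)
      - indicator {b<..} t *\<^sub>R (k (t - b) * f t) - k 0 * (indicator {a..b} t *\<^sub>R f t))"
  proof (rule integral_cong_AE)
    show "(\<lambda>t. LINT x|lebesgue. G x t) \<in> borel_measurable lebesgue"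
      using P.integrable_snd[OF G_int] by auto
    show "(\<lambda>t. indicator {a<..} t *\<^sub>R (k (t - a) * f t)
      - indicator {b<..} t *\<^sub>R (k (t - b) * f t) - k 0 * (indicator {a..b} t *\<^sub>R f t)) \<in> borel_measurable lebesgue"
      using k_int[of a] k_int[of b] f_int a ab
      by (intro borel_measurable_diff borel_measurable_times borel_measurable_const) (auto simp: set_integrable_def)
    show "AE t in lebesgue. (LINT x|lebesgue. G x t) = indicator {a<..} t *\<^sub>R (k (t - a) * f t)
      - indicator {b<..} t *\<^sub>R (k (t - b) * f t) - k 0 * (indicator {a..b} t *\<^sub>R f t)"
      using AE_lebesgue_neq[of a]
      by eventually_elim
        (use a ab in \<open>auto simp: inner_x F_def min_def algebra_simps split: split_indicator\<close>)
  qed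
  also have "\<dots> = tail_conv k f a - tail_conv k f b - k 0 * (LINT t:{a..b}|lebesgue. f t)"
    using k_int[of a] k_int[of b] f_int a ab
    by (simp add: tail_conv_def set_lebesgue_integral_def set_integrable_def del: mult_scaleR_right)
  finally have eq: "(LINT x:{a..b}|lebesgue. tail_conv k' f x)
      = tail_conv k f a - tail_conv k f b - k 0 * (LINT t:{a..b}|lebesgue. f t)" .
  have kf_int: "set_integrable lebesgue {a..b} (\<lambda>x. - k 0 * f x)"
    using f_int by (intro set_integrable_mult_right)
  have kf: "(LINT x:{a..b}|lebesgue. - k 0 * f x) = - k 0 * (LINT x:{a..b}|lebesgue. f x)"
    by (rule set_integral_mult_right)
  show "set_integrable lebesgue {a..b} (\<lambda>x. - k 0 * f x - tail_conv k' f x) \<and>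
      tail_conv k f b - tail_conv k f a = (LINT x:{a..b}|lebesgue. - k 0 * f x - tail_conv k' f x)"
    unfolding set_integral_diff(2)[OF kf_int tail_int] kf eq
    using set_integral_diff(1)[OF kf_int tail_int] by simp
qed

section \<open>The free equation u'' + lam^2 u = 0\<close>

text \<open>Up to a non-zero factor, exp(-i lam x) z(x) equals P - Q exp(-2 i lam x) with constants
  P and Q. The second term oscillates without decay, so a limit 0 forces P = Q = 0.\<close>

lemma free_solution_vanishes:
  assumes z: "\<And>x. x > 0 \<Longrightarrow> (z has_vector_derivative z1 x) (at x)"
    and z1: "loc_ac_deriv z1 z2"
    and eq: "AE x in lebesgue. 0 < x \<longrightarrow> z2 x = - complex_of_real (lam\<^sup>2) * z x"
    and lim: "((\<lambda>x. exp (- \<i> * of_real lam * of_real x) * z x) \<longlongrightarrow> 0) at_top"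
    and lam: "lam \<noteq> 0" and x: "x > 0"
  shows "z x = 0"
proof -
  have zcont: "continuous_on {0<..} z"
    using z by (meson continuous_at_imp_continuous_on greaterThan_iff has_vector_derivative_continuous)
  \<comment> \<open>Replacing \<open>z2\<close> by the continuous function that it equals almost
    everywhere makes \<open>z1\<close> differentiable at every point of the half-line.\<close>
  have "loc_ac_deriv z1 (\<lambda>x. - complex_of_real (lam\<^sup>2) * z x)"
    unfolding loc_ac_deriv_def
  proof (intro allI impI)
    fix a b :: real
    assume ab: "0 < a \<and> a \<le> b"
    let ?g = "\<lambda>x. - complex_of_real (lam\<^sup>2) * z x"
    have int: "set_integrable lebesgue {a..b} z2" and z1_eq: "z1 b - z1 a = (LINT t:{a..b}|lebesgue. z2 t)"
      using z1 ab by (auto simp: loc_ac_deriv_def)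
    have "continuous_on {a..b} ?g"
      by (intro continuous_intros continuous_on_subset[OF zcont]) (use ab in auto)
    then have int': "set_integrable lebesgue {a..b} ?g"
      using borel_integrable_compact[of "{a..b}" ?g]
      by (auto simp: set_integrable_def integrable_completion borel_measurable_integrable)
    have "(LINT t:{a..b}|lebesgue. z2 t) = (LINT t:{a..b}|lebesgue. ?g t)"
      unfolding set_lebesgue_integral_def
    proof (rule integral_cong_AE)
      show "AE t in lebesgue. indicator {a..b} t *\<^sub>R z2 t = indicator {a..b} t *\<^sub>R ?g t"
        using eq by eventually_elim (use ab in \<open>auto split: split_indicator\<close>)
    qed (use int int' in \<open>simp_all add: set_integrable_def borel_measurable_integrable\<close>)
    then show "set_integrable lebesgue {a..b} ?g \<and> z1 b - z1 a = (LINT t:{a..b}|lebesgue. ?g t)"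
      using int' z1_eq by simp
  qed
  then have z1': "(z1 has_vector_derivative - complex_of_real (lam\<^sup>2) * z x) (at x)" if "x > 0" for x
    by (rule loc_ac_deriv_has_vector_derivative[OF _ _ that]) (intro continuous_intros zcont)
  \<comment> \<open>For \<open>s = 1\<close> and \<open>s = -1\<close> these are constant multiples of the two coefficients of \<open>z\<close> in the basis
    \<open>exp (\<i> * lam * x)\<close>, \<open>exp (- \<i> * lam * x)\<close>.\<close>
  define W where "W s x = exp (- \<i> * of_real (s * lam) * of_real x) * (z1 x + \<i> * of_real (s * lam) * z x)"
    for s x :: real
  have W_const: "\<exists>c. \<forall>x>0. W s x = c" if s: "s * s = 1" for s
  proof -
    have "(W s has_derivative (\<lambda>h. 0)) (at x within {0<..})" if "x \<in> {0<..}" for x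
    proof -
      have e: "((\<lambda>x. exp (- \<i> * of_real (s * lam) * of_real x)) has_vector_derivative
          - \<i> * of_real (s * lam) * exp (- \<i> * of_real (s * lam) * of_real x)) (at x)"
        by (rule has_vector_derivative_real_field) (auto intro!: derivative_eq_intros)
      have "(W s has_vector_derivative
          exp (- \<i> * of_real (s * lam) * of_real x) * (- complex_of_real (lam\<^sup>2) * z x + \<i> * of_real (s * lam) * z1 x)
          + (- \<i> * of_real (s * lam) * exp (- \<i> * of_real (s * lam) * of_real x)) * (z1 x + \<i> * of_real (s * lam) * z x)) (at x)"
        unfolding W_def using that
        by (intro has_vector_derivative_mult e has_vector_derivative_add z1' has_vector_derivative_mult_right z) auto
      \<comment> \<open>The \<open>z1\<close> terms cancel, and what remains carries the factor s^2
        - 1.\<close>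
      also have "exp (- \<i> * of_real (s * lam) * of_real x) * (- complex_of_real (lam\<^sup>2) * z x + \<i> * of_real (s * lam) * z1 x)
          + (- \<i> * of_real (s * lam) * exp (- \<i> * of_real (s * lam) * of_real x)) * (z1 x + \<i> * of_real (s * lam) * z x)
          = exp (- \<i> * of_real (s * lam) * of_real x) * z x * of_real (lam\<^sup>2) * (of_real (s * s) - 1)"
        by (simp add: algebra_simps power2_eq_square)
      also have "\<dots> = 0"
        using s by simp
      finally show ?thesis
        by (simp add: has_vector_derivative_def has_derivative_at_withinI)
    qed
    from has_derivative_zero_constant[OF _ this] show ?thesis
      by auto
  qed
  obtain P Q where P: "\<And>x. x > 0 \<Longrightarrow> W 1 x = P" and Q: "\<And>x. x > 0 \<Longrightarrow> W (-1) x = Q"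
    using W_const[of 1] W_const[of "-1"] by auto
  define E where "E x = exp (- \<i> * of_real lam * of_real x)" for x :: real
  have E0: "E x \<noteq> 0" for x
    by (simp add: E_def)
  \<comment> \<open>Subtracting \<open>(E x)\<^sup>2 * W (-1) x\<close> from \<open>W 1 x\<close>
    eliminates \<open>z1 x\<close>.\<close>
  have rep: "2 * \<i> * of_real lam * (E x * z x) = P - (E x)\<^sup>2 * Q" if "x > 0" for x
  proof -
    have "W 1 x = E x * (z1 x + \<i> * of_real lam * z x)" "W (-1) x = (1 / E x) * (z1 x - \<i> * of_real lam * z x)"
      by (simp_all add: W_def E_def exp_minus field_simps)
    then have "P - (E x)\<^sup>2 * Q = E x * (z1 x + \<i> * of_real lam * z x) - (E x)\<^sup>2 * ((1 / E x) * (z1 x - \<i> * of_real lam * z x))"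
      using P[OF that] Q[OF that] by simp
    then show ?thesis
      using E0[of x] by (simp add: field_simps power2_eq_square)
  qed
  have lim0: "((\<lambda>x. P - (E x)\<^sup>2 * Q) \<longlongrightarrow> 0) at_top"
  proof (rule Lim_transform_eventually)
    show "((\<lambda>x. 2 * \<i> * of_real lam * (E x * z x)) \<longlongrightarrow> 0) at_top"
      using tendsto_mult[OF tendsto_const lim, of "2 * \<i> * of_real lam"] by (simp add: E_def)
    show "\<forall>\<^sub>F x in at_top. 2 * \<i> * of_real lam * (E x * z x) = P - (E x)\<^sup>2 * Q"
      using eventually_gt_at_top[of 0] by eventually_elim (rule rep)
  qed
  have sq: "(E x)\<^sup>2 = cis (- 2 * lam * x)" for x
    by (simp add: E_def cis_conv_exp exp_double[symmetric] mult_ac)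
  \<comment> \<open>\<open>(E x)\<^sup>2\<close> takes both values \<open>1\<close> and \<open>-1\<close> for arbitrarily large \<open>x\<close>.\<close>
  have limit_along: "P - w * Q = 0" if w: "\<And>n. cis (2 * pi * real n + c) = w" and wr: "w \<in> \<real>" for c w
  proof -
    \<comment> \<open>Dividing by the absolute value of \<open>lam\<close> sends \<open>X\<close> to
      +infinity for either sign of \<open>lam\<close>. For lam > 0 the phase changes sign and w
      becomes its conjugate, which is w again because w is real.\<close>
    define X where "X n = (2 * pi * real n + c) / (2 * \<bar>lam\<bar>)" for n :: nat
    have "filterlim X at_top sequentially"
      unfolding X_def using lam by real_asymp
    from filterlim_compose[OF lim0 this]
    have "(\<lambda>n. P - (E (X n))\<^sup>2 * Q) \<longlonglongrightarrow> 0" .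
    moreover have "(E (X n))\<^sup>2 = w" for n
    proof (cases "lam > 0")
      case True
      then have "(E (X n))\<^sup>2 = cnj (cis (2 * pi * real n + c))"
        by (simp add: sq X_def cis_cnj)
      then show ?thesis
        using w wr Reals_cnj_iff by auto
    next
      case False
      with lam have "- 2 * lam * X n = 2 * pi * real n + c"
        by (simp add: X_def field_simps)
      then show ?thesis
        using w by (simp add: sq)
    qed
    ultimately have "(\<lambda>n::nat. P - w * Q) \<longlonglongrightarrow> 0"
      by simp
    then show ?thesis
      by (simp add: LIMSEQ_const_iff)
  qed
  have c1: "cis (2 * pi * real n) = 1" for n
    by (metis cis_multiple_2pi Ints_of_nat of_int_of_nat_eq)
  have "P - 1 * Q = 0" "P - (-1) * Q = 0"
    using c1 by (intro limit_along[of 0] limit_along[of pi]; simp add: cis_mult[symmetric])+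
  then have "P = 0" "Q = 0"
    by auto
  then show ?thesis
    using rep[OF x] lam E0[of x] by simp
qed

section \<open>The functions \<open>psi\<close>\<close>

lemma psi_eq_tail_conv: "psi f lam = tail_conv (\<lambda>s. complex_of_real (sin (lam * s) / lam)) f"
  by (simp add: psi_def[abs_def] tail_conv_def[abs_def])

text \<open>The derivative of \<open>psi\<close> in x.\<close>

definition psi1 :: "(real \<Rightarrow> complex) \<Rightarrow> real \<Rightarrow> real \<Rightarrow> complex" where
  "psi1 f lam x = - tail_conv (\<lambda>s. complex_of_real (cos (lam * s))) f x"

text \<open>The cosine kernel equals 1 at 0, so the boundary term reproduces \<open>f\<close>; its
  derivative is -lam^2 times the kernel of \<open>psi\<close>. Thus \<open>psi\<close> solves u'' +
  lam^2 u = f.\<close>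

lemma loc_ac_deriv_psi1:
  assumes f: "set_integrable lebesgue {0<..} f" and lam: "lam \<noteq> 0"
  shows "loc_ac_deriv (psi1 f lam) (\<lambda>x. f x - complex_of_real (lam\<^sup>2) * psi f lam x)"
proof -
  let ?k = "\<lambda>s. complex_of_real (cos (lam * s))"
  let ?k' = "\<lambda>s. complex_of_real (- lam * sin (lam * s))"
  have "loc_ac_deriv (tail_conv ?k f) (\<lambda>x. - ?k 0 * f x - tail_conv ?k' f x)"
  proof (rule loc_ac_deriv_tail_conv[OF f])
    show "(?k has_vector_derivative ?k' s) (at s)" for s
      by (intro has_vector_derivative_of_real) (auto intro!: derivative_eq_intros simp flip: has_real_derivative_iff_has_vector_derivative)
    show "norm (?k s) \<le> 1" for s
      by simp
    show "norm (?k' s) \<le> \<bar>lam\<bar>" for s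
      by (simp add: norm_mult abs_mult mult_left_le)
  qed (intro continuous_intros)
  from loc_ac_deriv_cmult[OF this, of "-1"]
  have "loc_ac_deriv (psi1 f lam) (\<lambda>x. f x + tail_conv ?k' f x)"
    by (simp add: psi1_def[abs_def] add.commute)
  moreover have "tail_conv ?k' f x = - complex_of_real (lam\<^sup>2) * psi f lam x" for x
  proof -
    have "tail_conv ?k' f x = (LINT t:{x<..}|lebesgue. - complex_of_real (lam\<^sup>2) * (complex_of_real (sin (lam * (t - x)) / lam) * f t))"
      unfolding tail_conv_def using lam
      by (intro set_lebesgue_integral_cong) (auto simp: power2_eq_square)
    then show ?thesis
      by (simp only: set_integral_mult_right psi_def)
  qed
  ultimately show ?thesis
    by simp
qed

text \<open>The sine kernel vanishes at 0, so no boundary term appears. The density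
  \<open>psi1\<close> is itself locally absolutely continuous, hence continuous, and the bootstrap
  applies.\<close>

lemma psi_has_vector_derivative:
  assumes f: "set_integrable lebesgue {0<..} f" and lam: "lam \<noteq> 0" and x: "x > 0"
  shows "(psi f lam has_vector_derivative psi1 f lam x) (at x)"
proof -
  let ?k = "\<lambda>s. complex_of_real (sin (lam * s) / lam)"
  let ?k' = "\<lambda>s. complex_of_real (cos (lam * s))"
  have "loc_ac_deriv (tail_conv ?k f) (\<lambda>x. - ?k 0 * f x - tail_conv ?k' f x)"
  proof (rule loc_ac_deriv_tail_conv[OF f])
    show "(?k has_vector_derivative ?k' s) (at s)" for s
      using lam
      by (intro has_vector_derivative_of_real)
        (auto intro!: derivative_eq_intros simp flip: has_real_derivative_iff_has_vector_derivative)
    show "norm (?k s) \<le> 1 / \<bar>lam\<bar>" for s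
      by (simp add: norm_divide divide_right_mono)
    show "norm (?k' s) \<le> 1" for s
      by simp
  qed (intro continuous_intros)
  then have "loc_ac_deriv (psi f lam) (psi1 f lam)"
    by (simp add: psi_eq_tail_conv psi1_def[abs_def])
  then show ?thesis
    using loc_ac_deriv_continuous_on[OF loc_ac_deriv_psi1[OF f lam]] x
    by (rule loc_ac_deriv_has_vector_derivative)
qed

lemma psi_tendsto_0:
  assumes f: "set_integrable lebesgue {0<..} f"
  shows "(psi f lam \<longlongrightarrow> 0) at_top"
  unfolding psi_eq_tail_conv
proof (rule tail_conv_tendsto_0[OF f])
  show "norm (complex_of_real (sin (lam * s) / lam)) \<le> 1 / \<bar>lam\<bar>" for s
    by (simp add: norm_divide divide_right_mono)
  show "continuous_on UNIV (\<lambda>s. complex_of_real (sin (lam * s) / lam))"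
    unfolding divide_inverse by (intro continuous_intros)
qed

text \<open>\<open>psi\<close> is continuous and bounded on the half-line. This gives absolute
  convergence of the integrals \<open>phi\<close>.\<close>

lemma set_integrable_psi_mult:
  assumes f: "set_integrable lebesgue {0<..} f" and g: "set_integrable lebesgue {0<..} g" and lam: "lam \<noteq> 0"
  shows "set_integrable lebesgue {0<..} (\<lambda>x. psi f lam x * g x)"
proof (rule set_integrable_bounded_mult[OF g])
  show "continuous_on {0<..} (psi f lam)"
    using psi_has_vector_derivative[OF f lam]
    by (meson continuous_at_imp_continuous_on greaterThan_iff has_vector_derivative_continuous)
  show "norm (psi f lam x) \<le> 1 / \<bar>lam\<bar> * (LINT t:{0<..}|lebesgue. norm (f t))" if "x \<in> {0<..}" for x
    unfolding psi_eq_tail_conv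
  proof (rule norm_tail_conv_le[OF f])
    show "norm (complex_of_real (sin (lam * s) / lam)) \<le> 1 / \<bar>lam\<bar>" for s
      by (simp add: norm_divide divide_right_mono)
    show "continuous_on UNIV (\<lambda>s. complex_of_real (sin (lam * s) / lam))"
      unfolding divide_inverse by (intro continuous_intros)
  qed (use that in auto)
qed auto

section \<open>Sums and conjugates under the integral\<close>

lemma set_integrable_sum:
  fixes f :: "'i \<Rightarrow> 'a \<Rightarrow> 'b::{banach, second_countable_topology}"
  assumes "\<And>i. i \<in> I \<Longrightarrow> set_integrable M A (f i)"
  shows "set_integrable M A (\<lambda>x. \<Sum>i\<in>I. f i x)"
    and "(LINT x:A|M. \<Sum>i\<in>I. f i x) = (\<Sum>i\<in>I. LINT x:A|M. f i x)"
  using assms by (simp_all add: set_integrable_def set_lebesgue_integral_def scaleR_sum_right)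

lemma set_integral_cnj: "(LINT x:A|M. cnj (f x)) = cnj (LINT x:A|M. f x)"
  using Bochner_Integration.integral_cnj[of M "\<lambda>x. indicator A x *\<^sub>R f x"] by (simp add: set_lebesgue_integral_def)

lemma set_integrable_cnj: "set_integrable M A f \<Longrightarrow> set_integrable M A (\<lambda>x. cnj (f x))"
  using integrable_cnj[of M "\<lambda>x. indicator A x *\<^sub>R f x"] by (simp add: set_integrable_def)

section \<open>A plane wave plus a combination of the \<open>psi (v k) lam\<close>\<close>

text \<open>The coefficients stay free: existence takes \<open>c\<close> to be
  \<open>e_coef\<close>, while uniqueness starts from the integrals of an arbitrary solution, not
  yet known to equal \<open>e_coef\<close>.\<close>

definition jost_form ::
  "('n::finite \<Rightarrow> real) \<Rightarrow> ('n \<Rightarrow> real \<Rightarrow> complex) \<Rightarrow> real \<Rightarrow> complex \<Rightarrow> ('n \<Rightarrow> complex) \<Rightarrow> real \<Rightarrow> complex" where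
  "jost_form \<alpha> v lam A c x = exp (\<i> * complex_of_real lam * complex_of_real x) * A
     + (\<Sum>k\<in>UNIV. complex_of_real (\<alpha> k) * c k * psi (v k) lam x)"

definition jost_form1 ::
  "('n::finite \<Rightarrow> real) \<Rightarrow> ('n \<Rightarrow> real \<Rightarrow> complex) \<Rightarrow> real \<Rightarrow> complex \<Rightarrow> ('n \<Rightarrow> complex) \<Rightarrow> real \<Rightarrow> complex" where
  "jost_form1 \<alpha> v lam A c x =
     \<i> * complex_of_real lam * exp (\<i> * complex_of_real lam * complex_of_real x) * A
     + (\<Sum>k\<in>UNIV. complex_of_real (\<alpha> k) * c k * psi1 (v k) lam x)"

lemma exp_has_vector_derivative:
  "((\<lambda>x. exp (c * complex_of_real x)) has_vector_derivative c * exp (c * complex_of_real x)) (at x)"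
  by (rule has_vector_derivative_real_field) (auto intro!: derivative_eq_intros)

lemma jost_form_has_vector_derivative:
  assumes v: "\<And>k. set_integrable lebesgue {0<..} (v k)" and lam: "lam \<noteq> 0" and x: "x > 0"
  shows "(jost_form \<alpha> v lam A c has_vector_derivative jost_form1 \<alpha> v lam A c x) (at x)"
  unfolding jost_form_def[abs_def] jost_form1_def
  by (intro has_vector_derivative_add has_vector_derivative_mult_left has_vector_derivative_sum
      has_vector_derivative_mult_right exp_has_vector_derivative psi_has_vector_derivative v lam x)

text \<open>The plane wave solves the free equation, and each \<open>psi (v k) lam\<close>
  contributes the source \<open>v k\<close>.\<close>

lemma loc_ac_deriv_jost_form1:
  assumes v: "\<And>k. set_integrable lebesgue {0<..} (v k)" and lam: "lam \<noteq> 0"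
  shows "loc_ac_deriv (jost_form1 \<alpha> v lam A c)
    (\<lambda>x. (\<Sum>k\<in>UNIV. complex_of_real (\<alpha> k) * v k x * c k) - complex_of_real (lam\<^sup>2) * jost_form \<alpha> v lam A c x)"
proof -
  let ?e = "\<lambda>x. exp (\<i> * complex_of_real lam * complex_of_real x)"
  have "loc_ac_deriv (\<lambda>x. \<i> * complex_of_real lam * ?e x * A) (\<lambda>x. \<i> * complex_of_real lam * (\<i> * complex_of_real lam * ?e x) * A)"
    by (intro loc_ac_deriv_C1 has_vector_derivative_mult_left has_vector_derivative_mult_right
        exp_has_vector_derivative continuous_intros)
  moreover have "loc_ac_deriv (\<lambda>x. \<Sum>k\<in>UNIV. complex_of_real (\<alpha> k) * c k * psi1 (v k) lam x)
      (\<lambda>x. \<Sum>k\<in>UNIV. complex_of_real (\<alpha> k) * c k * (v k x - complex_of_real (lam\<^sup>2) * psi (v k) lam x))"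
    by (intro loc_ac_deriv_sum loc_ac_deriv_cmult loc_ac_deriv_psi1 v lam)
  ultimately
  have "loc_ac_deriv (jost_form1 \<alpha> v lam A c) (\<lambda>x. \<i> * complex_of_real lam * (\<i> * complex_of_real lam * ?e x) * A
      + (\<Sum>k\<in>UNIV. complex_of_real (\<alpha> k) * c k * (v k x - complex_of_real (lam\<^sup>2) * psi (v k) lam x)))"
    unfolding jost_form1_def[abs_def] by (rule loc_ac_deriv_add)
  also have "(\<lambda>x. \<i> * complex_of_real lam * (\<i> * complex_of_real lam * ?e x) * A
      + (\<Sum>k\<in>UNIV. complex_of_real (\<alpha> k) * c k * (v k x - complex_of_real (lam\<^sup>2) * psi (v k) lam x)))
    = (\<lambda>x. (\<Sum>k\<in>UNIV. complex_of_real (\<alpha> k) * v k x * c k) - complex_of_real (lam\<^sup>2) * jost_form \<alpha> v lam A c x)"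
    by (rule ext) (simp add: jost_form_def algebra_simps sum_subtractf sum_distrib_left power2_eq_square)
  finally show ?thesis .
qed

lemma jost_form_tendsto:
  assumes v: "\<And>k. set_integrable lebesgue {0<..} (v k)"
  shows "((\<lambda>x. exp (- \<i> * complex_of_real lam * complex_of_real x) * jost_form \<alpha> v lam A c x) \<longlongrightarrow> A) at_top"
proof -
  let ?e = "\<lambda>x. exp (- \<i> * complex_of_real lam * complex_of_real x)"
  let ?S = "\<lambda>x. \<Sum>k\<in>UNIV. complex_of_real (\<alpha> k) * c k * psi (v k) lam x"
  have "(?S \<longlongrightarrow> 0) at_top"
    by (intro tendsto_null_sum tendsto_mult_right_zero psi_tendsto_0 v)
  then have "((\<lambda>x. norm (?S x)) \<longlongrightarrow> 0) at_top"
    by (rule tendsto_norm_zero)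
  \<comment> \<open>The exponential has modulus one for real \<open>lam\<close>, so only the norm of
    \<open>?S x\<close> matters.\<close>
  then have "((\<lambda>x. ?e x * ?S x) \<longlongrightarrow> 0) at_top"
    by (rule Lim_null_comparison[rotated]) (simp add: norm_mult)
  then have "((\<lambda>x. A + ?e x * ?S x) \<longlongrightarrow> A + 0) at_top"
    by (intro tendsto_add tendsto_const)
  also have "(\<lambda>x. A + ?e x * ?S x) = (\<lambda>x. ?e x * jost_form \<alpha> v lam A c x)"
    by (rule ext) (simp add: jost_form_def distrib_left exp_minus field_simps)
  finally show ?thesis
    by simp
qed

lemma
  assumes v: "\<And>k. set_integrable lebesgue {0<..} (v k)" and lam: "lam \<noteq> 0"
  shows set_integrable_cnj_jost_form: "set_integrable lebesgue {0<..} (\<lambda>t. cnj (v k t) * jost_form \<alpha> v lam A c t)"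
    and set_integral_cnj_jost_form: "(LINT t:{0<..}|lebesgue. cnj (v k t) * jost_form \<alpha> v lam A c t)
      = A * vtilde_star (v k) lam + (\<Sum>s\<in>UNIV. complex_of_real (\<alpha> s) * c s * phi v lam s k)"
proof -
  let ?e = "\<lambda>x. exp (\<i> * complex_of_real lam * complex_of_real x)"
  have eq: "(\<lambda>t. cnj (v k t) * jost_form \<alpha> v lam A c t)
      = (\<lambda>t. A * (?e t * cnj (v k t)) + (\<Sum>s\<in>UNIV. complex_of_real (\<alpha> s) * c s * (psi (v s) lam t * cnj (v k t))))"
    by (rule ext) (simp add: jost_form_def algebra_simps sum_distrib_left)
  have e: "set_integrable lebesgue {0<..} (\<lambda>t. ?e t * cnj (v k t))"
    by (rule set_integrable_bounded_mult[of _ _ _ 1])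
      (auto intro!: set_integrable_cnj v continuous_intros)
  have p: "set_integrable lebesgue {0<..} (\<lambda>t. psi (v s) lam t * cnj (v k t))" for s
    by (intro set_integrable_psi_mult set_integrable_cnj v lam)
  \<comment> \<open>Conjugation passes through the integral and, \<open>lam\<close> and x being
    real, turns exp(-i lam x) into exp(i lam x).\<close>
  have vt: "(LINT t:{0<..}|lebesgue. ?e t * cnj (v k t)) = vtilde_star (v k) lam"
    by (simp add: vtilde_star_def vtilde_def exp_cnj flip: set_integral_cnj)
  show "set_integrable lebesgue {0<..} (\<lambda>t. cnj (v k t) * jost_form \<alpha> v lam A c t)"
    unfolding eq by (intro set_integral_add(1) set_integrable_sum(1) set_integrable_mult_right e p)
  show "(LINT t:{0<..}|lebesgue. cnj (v k t) * jost_form \<alpha> v lam A c t)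
      = A * vtilde_star (v k) lam + (\<Sum>s\<in>UNIV. complex_of_real (\<alpha> s) * c s * phi v lam s k)"
    unfolding eq
    by (subst set_integral_add(2); (subst set_integrable_sum(2))?;
        (intro set_integrable_sum(1) set_integrable_mult_right e p)?)
      (simp add: vt phi_def)
qed

section \<open>The linear system for the coefficients\<close>

text \<open>The system says that \<open>M_mat\<close> maps the vector -c/e0 to the column of the
  \<open>vtilde_star (v k) lam\<close>. Its determinant \<open>e0\<close> is non-zero, so Cramer's
  rule gives -c k/e0 = det(\<open>M_mat_repl\<close>)/e0; cancelling leaves the sign in
  \<open>e_coef\<close>.\<close>

lemma e_coef_unique:
  assumes "e0 \<alpha> v lam \<noteq> 0"
  shows "(\<forall>k. c k = e0 \<alpha> v lam * vtilde_star (v k) lam + (\<Sum>s\<in>UNIV. complex_of_real (\<alpha> s) * c s * phi v lam s k))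
    \<longleftrightarrow> c = (\<lambda>k. e_coef \<alpha> v k lam)"
proof -
  let ?M = "M_mat \<alpha> v lam" and ?d = "e0 \<alpha> v lam"
  let ?b = "\<chi> k. vtilde_star (v k) lam"
  have "(?M *v (\<chi> k. - c k / ?d)) $ k = ?b $ k
      \<longleftrightarrow> c k = ?d * vtilde_star (v k) lam + (\<Sum>s\<in>UNIV. complex_of_real (\<alpha> s) * c s * phi v lam s k)" for k
  proof -
    have "(?M *v (\<chi> k. - c k / ?d)) $ k
        = (c k - (\<Sum>s\<in>UNIV. complex_of_real (\<alpha> s) * c s * phi v lam s k)) / ?d"
    proof -
      have "(?M *v (\<chi> k. - c k / ?d)) $ k
          = (\<Sum>s\<in>UNIV. (if s = k then c s / ?d else 0) - complex_of_real (\<alpha> s) * c s * phi v lam s k / ?d)"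
        unfolding matrix_vector_mult_def M_mat_def
        by (auto intro!: sum.cong simp: algebra_simps diff_divide_distrib)
      then show ?thesis
        by (simp add: sum_subtractf diff_divide_distrib sum_divide_distrib)
    qed
    then show ?thesis
      using assms by (auto simp: field_simps)
  qed
  then have "(\<forall>k. c k = ?d * vtilde_star (v k) lam + (\<Sum>s\<in>UNIV. complex_of_real (\<alpha> s) * c s * phi v lam s k))
      \<longleftrightarrow> ?M *v (\<chi> k. - c k / ?d) = ?b"
    by (simp add: vec_eq_iff)
  also have "\<dots> \<longleftrightarrow> (\<chi> k. - c k / ?d) = (\<chi> k. det (\<chi> i j. if j = k then ?b $ i else ?M $ i $ j) / det ?M)"
    using assms by (intro cramer) (simp add: e0_def)
  also have "\<dots> \<longleftrightarrow> (\<forall>k. - c k / ?d = det (M_mat_repl \<alpha> v k lam) / ?d)"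
    by (simp add: vec_eq_iff M_mat_repl_def e0_def cong: if_cong)
  also have "\<dots> \<longleftrightarrow> c = (\<lambda>k. e_coef \<alpha> v k lam)"
  proof -
    have "- c k / ?d = w / ?d \<longleftrightarrow> c k = - w" for k w
      using assms by (metis divide_cancel_right minus_minus)
    then show ?thesis
      by (simp only: e_coef_def fun_eq_iff)
  qed
  finally show ?thesis .
qed

section \<open>The nonlocal term, and independence of values off the half-line\<close>

text \<open>The kernel has finite rank, so the nonlocal term depends on \<open>y\<close> only
  through finitely many numbers.\<close>

lemma nonlocal_term_eq:
  fixes \<alpha> :: "'n::finite \<Rightarrow> real"
  assumes "\<And>k. set_integrable lebesgue {0<..} (\<lambda>t. cnj (v k t) * y t)"
  shows "(LINT t:{0<..}|lebesgue. (\<Sum>k\<in>UNIV. complex_of_real (\<alpha> k) * v k x * cnj (v k t)) * y t)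
    = (\<Sum>k\<in>UNIV. complex_of_real (\<alpha> k) * v k x * (LINT t:{0<..}|lebesgue. cnj (v k t) * y t))"
proof -
  have "(\<lambda>t. (\<Sum>k\<in>UNIV. complex_of_real (\<alpha> k) * v k x * cnj (v k t)) * y t)
      = (\<lambda>t. \<Sum>k\<in>UNIV. complex_of_real (\<alpha> k) * v k x * (cnj (v k t) * y t))"
    by (simp add: sum_distrib_right mult.assoc)
  then show ?thesis
    using assms by (simp add: set_integrable_sum(2))
qed

text \<open>Values at non-positive arguments are arbitrary. Each x > 0 has a neighbourhood inside
  the open half-line, so derivatives there ignore them.\<close>

lemma is_solution_cong:
  assumes "\<And>x. x > 0 \<Longrightarrow> y x = z x"
  shows "is_solution \<alpha> v lam y \<longleftrightarrow> is_solution \<alpha> v lam z"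
proof -
  have "(y has_vector_derivative D) (at x) \<longleftrightarrow> (z has_vector_derivative D) (at x)" if "x > 0" for x D
  proof -
    have "\<forall>\<^sub>F t in nhds x. y t = z t"
      using eventually_nhds_in_open[of "{0<..}" x] that by (auto elim!: eventually_mono simp: assms)
    then show ?thesis
      using assms[OF that] by (intro has_vector_derivative_cong_ev) auto
  qed
  moreover have "set_integrable lebesgue {0<..} (\<lambda>t. g t * y t) \<longleftrightarrow> set_integrable lebesgue {0<..} (\<lambda>t. g t * z t)" for g
    by (intro set_integrable_cong) (auto simp: assms)
  moreover have "(LINT t:{0<..}|lebesgue. g t * y t) = (LINT t:{0<..}|lebesgue. g t * z t)" for g
    by (intro set_lebesgue_integral_cong) (auto simp: assms)
  ultimately show ?thesis
    using assms unfolding is_solution_def by (simp cong: imp_cong)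
qed

lemma is_Jost_solution_cong:
  assumes "\<And>x. x > 0 \<Longrightarrow> y x = z x"
  shows "is_Jost_solution \<alpha> v lam y \<longleftrightarrow> is_Jost_solution \<alpha> v lam z"
proof -
  have "\<forall>\<^sub>F x in at_top. exp (- \<i> * complex_of_real lam * complex_of_real x) * y x
      = exp (- \<i> * complex_of_real lam * complex_of_real x) * z x"
    using eventually_gt_at_top[of 0] by eventually_elim (simp add: assms)
  moreover have "is_solution \<alpha> v lam y \<longleftrightarrow> is_solution \<alpha> v lam z"
    using assms by (rule is_solution_cong)
  ultimately show ?thesis
    by (simp only: is_Jost_solution_def tendsto_cong)
qed

section \<open>Existence and uniqueness of the Jost solution\<close>

lemma is_Jost_solution_jost_form:
  assumes v: "\<And>k. set_integrable lebesgue {0<..} (v k)" and lam: "lam \<noteq> 0" and e0: "e0 \<alpha> v lam \<noteq> 0"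
  shows "is_Jost_solution \<alpha> v lam (jost_form \<alpha> v lam (e0 \<alpha> v lam) (\<lambda>k. e_coef \<alpha> v k lam))"
proof -
  let ?y = "jost_form \<alpha> v lam (e0 \<alpha> v lam) (\<lambda>k. e_coef \<alpha> v k lam)"
  have int: "set_integrable lebesgue {0<..} (\<lambda>t. cnj (v k t) * ?y t)" for k
    by (rule set_integrable_cnj_jost_form[OF v lam])
  \<comment> \<open>The integral is the right-hand side of the linear system at
    \<open>c = e_coef\<close>, so the claim is that \<open>e_coef\<close> solves that
    system.\<close>
  have "(LINT t:{0<..}|lebesgue. cnj (v k t) * ?y t) = e_coef \<alpha> v k lam" for k
    unfolding set_integral_cnj_jost_form[where v = v, OF v lam]
    using iffD2[OF e_coef_unique[OF e0] refl, THEN spec, of k] by (rule sym)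
  then have nl: "(LINT t:{0<..}|lebesgue. (\<Sum>k\<in>UNIV. complex_of_real (\<alpha> k) * v k x * cnj (v k t)) * ?y t)
      = (\<Sum>k\<in>UNIV. complex_of_real (\<alpha> k) * v k x * e_coef \<alpha> v k lam)" for x
    by (simp add: nonlocal_term_eq[OF int])
  have "is_solution \<alpha> v lam ?y"
    unfolding is_solution_def
  proof (intro conjI allI exI impI)
    show "loc_ac_deriv (jost_form1 \<alpha> v lam (e0 \<alpha> v lam) (\<lambda>k. e_coef \<alpha> v k lam))
        (\<lambda>x. (\<Sum>k\<in>UNIV. complex_of_real (\<alpha> k) * v k x * e_coef \<alpha> v k lam) - complex_of_real (lam\<^sup>2) * ?y x)"
      by (rule loc_ac_deriv_jost_form1[OF v lam])
  qed (use int in \<open>auto intro!: jost_form_has_vector_derivative v lam simp: nl\<close>)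
  then show ?thesis
    using jost_form_tendsto[where v = v, OF v] unfolding is_Jost_solution_def by blast
qed

lemma is_Jost_solution_imp_eq_jost_form:
  assumes v: "\<And>k. set_integrable lebesgue {0<..} (v k)" and lam: "lam \<noteq> 0" and e0: "e0 \<alpha> v lam \<noteq> 0"
    and y: "is_Jost_solution \<alpha> v lam y" and x: "x > 0"
  shows "y x = jost_form \<alpha> v lam (e0 \<alpha> v lam) (\<lambda>k. e_coef \<alpha> v k lam) x"
proof -
  have int: "set_integrable lebesgue {0<..} (\<lambda>t. cnj (v k t) * y t)" for k
    using y by (auto simp: is_Jost_solution_def is_solution_def)
  obtain y1 y2 where y1: "\<And>x. x > 0 \<Longrightarrow> (y has_vector_derivative y1 x) (at x)"
    and y2: "loc_ac_deriv y1 y2"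
    and eq: "AE x in lebesgue. 0 < x \<longrightarrow> - y2 x + (LINT t:{0<..}|lebesgue.
        (\<Sum>k\<in>UNIV. complex_of_real (\<alpha> k) * v k x * cnj (v k t)) * y t) = complex_of_real (lam\<^sup>2) * y x"
    and lim: "((\<lambda>x. exp (- \<i> * complex_of_real lam * complex_of_real x) * y x) \<longlongrightarrow> e0 \<alpha> v lam) at_top"
    using y by (auto simp: is_Jost_solution_def is_solution_def)
  define c where "c k = (LINT t:{0<..}|lebesgue. cnj (v k t) * y t)" for k
  let ?f = "jost_form \<alpha> v lam (e0 \<alpha> v lam) c" and ?f1 = "jost_form1 \<alpha> v lam (e0 \<alpha> v lam) c"
  let ?f2 = "\<lambda>x. (\<Sum>k\<in>UNIV. complex_of_real (\<alpha> k) * v k x * c k) - complex_of_real (lam\<^sup>2) * ?f x"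
  have y_eq: "y x = ?f x" if "x > 0" for x
  proof -
    \<comment> \<open>\<open>y\<close> and \<open>?f\<close> have the same source and the same
      limit, so their difference is a free solution with limit 0. Writing it as a sum with a
      multiple lets the rules for sums and multiples apply.\<close>
    have "y x + - 1 * ?f x = 0"
    proof (rule free_solution_vanishes[OF _ _ _ _ lam that])
      show "((\<lambda>x. y x + - 1 * ?f x) has_vector_derivative y1 x + - 1 * ?f1 x) (at x)" if "x > 0" for x
        by (intro has_vector_derivative_add has_vector_derivative_mult_right y1
            jost_form_has_vector_derivative v lam that)
      show "loc_ac_deriv (\<lambda>x. y1 x + - 1 * ?f1 x) (\<lambda>x. y2 x + - 1 * ?f2 x)"
        by (intro loc_ac_deriv_add loc_ac_deriv_cmult y2 loc_ac_deriv_jost_form1 v lam)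
      show "AE x in lebesgue. 0 < x \<longrightarrow> y2 x + - 1 * ?f2 x = - complex_of_real (lam\<^sup>2) * (y x + - 1 * ?f x)"
        using eq
      proof eventually_elim
        case (elim x)
        show ?case
        proof
          assume "0 < x"
          with elim have "- y2 x + (\<Sum>k\<in>UNIV. complex_of_real (\<alpha> k) * v k x * c k) = complex_of_real (lam\<^sup>2) * y x"
            by (simp only: nonlocal_term_eq[OF int] c_def)
          then have "y2 x = (\<Sum>k\<in>UNIV. complex_of_real (\<alpha> k) * v k x * c k) - complex_of_real (lam\<^sup>2) * y x"
            by (simp add: algebra_simps)
          then show "y2 x + - 1 * ?f2 x = - complex_of_real (lam\<^sup>2) * (y x + - 1 * ?f x)"
            by (simp add: algebra_simps)
        qed
      qed
      show "((\<lambda>x. exp (- \<i> * complex_of_real lam * complex_of_real x) * (y x + - 1 * ?f x)) \<longlongrightarrow> 0) at_top"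
        using tendsto_diff[OF lim jost_form_tendsto[where v = v and c = c and A = "e0 \<alpha> v lam", OF v]]
        by (simp add: right_diff_distrib)
    qed
    then show ?thesis
      by simp
  qed
  \<comment> \<open>Self-consistency: substituting the formula for \<open>y\<close> into the
    integrals that define \<open>c\<close> yields the linear system.\<close>
  have "c k = e0 \<alpha> v lam * vtilde_star (v k) lam + (\<Sum>s\<in>UNIV. complex_of_real (\<alpha> s) * c s * phi v lam s k)"
    for k
  proof -
    have "c k = (LINT t:{0<..}|lebesgue. cnj (v k t) * ?f t)"
      unfolding c_def by (intro set_lebesgue_integral_cong) (auto simp: y_eq[unfolded c_def[abs_def]])
    also have "\<dots> = e0 \<alpha> v lam * vtilde_star (v k) lam + (\<Sum>s\<in>UNIV. complex_of_real (\<alpha> s) * c s * phi v lam s k)"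
      by (rule set_integral_cnj_jost_form[OF v lam])
    finally show ?thesis .
  qed
  then have "c = (\<lambda>k. e_coef \<alpha> v k lam)"
    unfolding e_coef_unique[OF e0, symmetric] by (rule allI)
  then show ?thesis
    using y_eq[OF x] by simp
qed

text \<open>Speaking of the Jost solution asserts existence and uniqueness, hence the equivalence.
  Agreement is on the half-line, the only place where \<open>y\<close> is determined.\<close>

theorem theorem1p1:
  fixes \<alpha> :: "'n::finite \<Rightarrow> real"
    and v :: "'n \<Rightarrow> real \<Rightarrow> complex"
    and lam :: real
  assumes "\<And>k. \<alpha> k \<noteq> 0"
    and "\<And>k. weighted_L2 (v k)"
    and "lin_indep_halfline v"
    and "lam \<noteq> 0"
    and "e0 \<alpha> v lam \<noteq> 0"
  shows "\<forall>y. is_Jost_solution \<alpha> v lam y \<longleftrightarrow>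
           (\<forall>x>0. y x = exp (\<i> * complex_of_real lam * complex_of_real x) * e0 \<alpha> v lam
              + (\<Sum>k\<in>UNIV. complex_of_real (\<alpha> k) * e_coef \<alpha> v k lam * psi (v k) lam x))"
proof -
  have v: "set_integrable lebesgue {0<..} (v k)" for k
    using assms(2) by (rule weighted_L2_imp_set_integrable)
  have "\<forall>y. is_Jost_solution \<alpha> v lam y \<longleftrightarrow>
      (\<forall>x>0. y x = jost_form \<alpha> v lam (e0 \<alpha> v lam) (\<lambda>k. e_coef \<alpha> v k lam) x)"
  proof (intro allI iffI impI)
    fix y
    assume "\<forall>x>0. y x = jost_form \<alpha> v lam (e0 \<alpha> v lam) (\<lambda>k. e_coef \<alpha> v k lam) x"
    then have "is_Jost_solution \<alpha> v lam y \<longleftrightarrow>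
        is_Jost_solution \<alpha> v lam (jost_form \<alpha> v lam (e0 \<alpha> v lam) (\<lambda>k. e_coef \<alpha> v k lam))"
      by (intro is_Jost_solution_cong) auto
    then show "is_Jost_solution \<alpha> v lam y"
      using is_Jost_solution_jost_form[where v = v, OF v assms(4,5)] by blast
  qed (rule is_Jost_solution_imp_eq_jost_form[OF v assms(4,5)])
  then show ?thesis
    unfolding jost_form_def .
qed

end
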